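(* Let $g_1,\dots,g_m:\mathbb{R}^n\to\mathbb{R}$ be continuously differentiable, let $\Omega=\{x\in\mathbb{R}^n \mid g_i(x)\le 0,\ i=1,\dots,m\}$, and let $x^*\in\Omega$. If the Mangasarian--Fromovitz constraint qualification (MFCQ) holds at $x^*$, i.e. there exists $d\in\mathbb{R}^n$ such that $\langle\nabla g_i(x^* ),d\rangle<0$ for all $i\in\{1,\dots,m\}$ with $g_i(x^* )=0$, then the Unified Separation Condition (USC) holds at $x^*$, i.e. there exist a neighborhood $B$ of $x^*$ and a constant $a>0$ such that $$\operatorname{dist}\bigl(0,\partial\phi(x)\bigr)\ge a\quad\text{for all } x\in B\setminus\Omega,$$ where $\phi(x)=\max\{0,g_1(x),\dots,g_m(x)\}$.
   Context: For $A\subseteq\mathbb{R}^n$, $\operatorname{dist}(0,A)=\inf_{v\in A}\|v\|_2$. The subdifferential $\partial\phi(x)$ is the convex compact set for which the directional derivative satisfies $\phi'(x;d)=\max_{v\in\partial\phi(x)}\langle v,d\rangle$ for all $d\in\mathbb{R}^n$. For $\phi=\max\{0,g_1,\dots,g_m\}$ with continuously differentiable $g_i$ and a point $x\notin\Omega$ (equivalently $\phi(x)>0$), it is given by $\partial\phi(x)=\operatorname{conv}\{\nabla g_i(x)\mid i\in\{1,\dots,m\},\ g_i(x)=\phi(x)\}$. *)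

theory Defs
  imports "HOL-Analysis.Analysis"
begin

definition gradient :: "(real ^ 'n \<Rightarrow> real) \<Rightarrow> real ^ 'n \<Rightarrow> real ^ 'n" where
  "gradient f x = (THE v. GDERIV f x :> v)"

definition continuously_differentiable :: "(real ^ 'n \<Rightarrow> real) \<Rightarrow> bool" where
  "continuously_differentiable f \<longleftrightarrow>
     (\<forall>x. f differentiable (at x)) \<and> continuous_on UNIV (gradient f)"

text \<open>One-sided directional derivative, as a relation so that existence of the limit is included.\<close>

definition has_directional_derivative ::
    "(real ^ 'n \<Rightarrow> real) \<Rightarrow> real ^ 'n \<Rightarrow> real ^ 'n \<Rightarrow> real \<Rightarrow> bool" where
  "has_directional_derivative \<phi> x d D \<longleftrightarrow>
     ((\<lambda>t. (\<phi> (x + t *\<^sub>R d) - \<phi> x) / t) \<longlongrightarrow> D) (at_right 0)"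

text \<open>The witness \<open>v\<close> expresses that the maximum of \<open>\<langle>v, d\<rangle>\<close> over \<open>C\<close> is attained and equals
  the directional derivative; in particular \<open>C\<close> is nonempty. A compact convex set is determined by
  its support function, so this predicate holds for at most one \<open>C\<close>.\<close>

definition is_subdifferential ::
    "(real ^ 'n \<Rightarrow> real) \<Rightarrow> real ^ 'n \<Rightarrow> (real ^ 'n) set \<Rightarrow> bool" where
  "is_subdifferential \<phi> x C \<longleftrightarrow> convex C \<and> compact C \<and>
     (\<forall>d. \<exists>v\<in>C. (\<forall>w\<in>C. w \<bullet> d \<le> v \<bullet> d) \<and> has_directional_derivative \<phi> x d (v \<bullet> d))"

definition subdifferential :: "(real ^ 'n \<Rightarrow> real) \<Rightarrow> real ^ 'n \<Rightarrow> (real ^ 'n) set" where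
  "subdifferential \<phi> x = (THE C. is_subdifferential \<phi> x C)"

definition feasible_set :: "nat \<Rightarrow> (nat \<Rightarrow> real ^ 'n \<Rightarrow> real) \<Rightarrow> (real ^ 'n) set" where
  "feasible_set m g = {x. \<forall>i\<in>{1..m}. g i x \<le> 0}"

definition max_function :: "nat \<Rightarrow> (nat \<Rightarrow> real ^ 'n \<Rightarrow> real) \<Rightarrow> real ^ 'n \<Rightarrow> real" where
  "max_function m g x = Max (insert 0 ((\<lambda>i. g i x) ` {1..m}))"

definition MFCQ :: "nat \<Rightarrow> (nat \<Rightarrow> real ^ 'n \<Rightarrow> real) \<Rightarrow> real ^ 'n \<Rightarrow> bool" where
  "MFCQ m g x \<longleftrightarrow> (\<exists>d. \<forall>i\<in>{1..m}. g i x = 0 \<longrightarrow> gradient (g i) x \<bullet> d < 0)"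

definition USC :: "nat \<Rightarrow> (nat \<Rightarrow> real ^ 'n \<Rightarrow> real) \<Rightarrow> real ^ 'n \<Rightarrow> bool" where
  "USC m g x0 \<longleftrightarrow> (\<exists>B a. open B \<and> x0 \<in> B \<and> a > 0 \<and>
     (\<forall>x \<in> B - feasible_set m g. infdist 0 (subdifferential (max_function m g) x) \<ge> a))"

end

theory Submission
  imports Defs
begin

text \<open>Near \<open>xstar\<close> a constraint inactive at \<open>xstar\<close> stays negative, and by continuity of the gradients
  the MFCQ direction \<open>d\<close> satisfies \<open>\<nabla> g\<^sub>i(x) \<bullet> d < -c\<close> for a fixed \<open>c > 0\<close> and all \<open>i\<close>
  active at \<open>xstar\<close>. At an infeasible \<open>x\<close> nearby, \<open>g\<^sub>i(x) = \<phi>(x) > 0\<close> forces \<open>i\<close> to be active at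
  \<open>xstar\<close>; hence the halfspace \<open>v \<bullet> d \<le> -c\<close> contains the convex hull of the gradients of the
  maximal \<open>g\<^sub>i\<close>, which is \<open>\<partial>\<phi>(x)\<close>, and Cauchy--Schwarz bounds the norm of its elements from below.\<close>

section \<open>Gradients and one-sided directional derivatives\<close>

lemma GDERIV_gradient:
  assumes "f differentiable (at x)"
  shows "GDERIV f x :> gradient f x"
proof -
  obtain f' where f': "(f has_derivative f') (at x)"
    using assms by (auto simp: differentiable_def)
  then have "linear f'"
    by (simp add: has_derivative_linear)
  \<comment> \<open>\<open>adjoint f' 1\<close> is the Riesz vector of the functional
    \<open>f'\<close>, since the inner product with 1 in \<open>real\<close> is the
    identity.\<close>
  then have "f' = (\<lambda>h. h \<bullet> adjoint f' 1)"
    by (simp add: adjoint_works)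
  then have "GDERIV f x :> adjoint f' 1"
    using f' by (simp add: gderiv_def)
  moreover have "v = w" if "GDERIV f x :> v" "GDERIV f x :> w" for v w
  proof -
    have "(\<lambda>h. h \<bullet> v) = (\<lambda>h. h \<bullet> w)"
      using that unfolding gderiv_def by (rule has_derivative_unique)
    then show ?thesis
      by (metis vector_eq_ldot)
  qed
  ultimately show ?thesis
    unfolding gradient_def by (metis (mono_tags, lifting) theI)
qed

lemma has_directional_derivative_gradient:
  assumes "f differentiable (at x)"
  shows "has_directional_derivative f x d (gradient f x \<bullet> d)"
proof -
  \<comment> \<open>The base point is written \<open>x + 0 *\<^sub>R d\<close>, the value at 0 of
    the line through \<open>x\<close>, so that the chain rule applies directly.\<close>
  have "(f has_derivative (\<lambda>h. h \<bullet> gradient f x)) (at (x + 0 *\<^sub>R d))"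
    using GDERIV_gradient[OF assms] by (simp add: gderiv_def)
  moreover have "((\<lambda>t. x + t *\<^sub>R d) has_derivative (\<lambda>t. t *\<^sub>R d)) (at 0)"
    by (auto intro!: derivative_eq_intros)
  ultimately have "((\<lambda>t. f (x + t *\<^sub>R d)) has_derivative (\<lambda>t. (t *\<^sub>R d) \<bullet> gradient f x)) (at 0)"
    by (rule has_derivative_compose[rotated])
  then have "((\<lambda>t. f (x + t *\<^sub>R d)) has_real_derivative gradient f x \<bullet> d) (at 0)"
    unfolding has_field_derivative_def
    by (rule has_derivative_eq_rhs) (simp add: fun_eq_iff inner_commute)
  then have "((\<lambda>t. (f (x + t *\<^sub>R d) - f x) / t) \<longlongrightarrow> gradient f x \<bullet> d) (at 0)"
    by (simp add: DERIV_def)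
  then show ?thesis
    unfolding has_directional_derivative_def
    by (rule tendsto_mono[rotated]) (simp add: at_le)
qed

section \<open>Uniqueness of the subdifferential\<close>

lemma has_directional_derivative_unique:
  assumes "has_directional_derivative \<phi> x d D" "has_directional_derivative \<phi> x d E"
  shows "D = E"
  using assms unfolding has_directional_derivative_def
  by (rule tendsto_unique[rotated]) simp

text \<open>Both sets have the directional derivative as their support function. A point of
  \<open>D\<close> outside the closed convex set \<open>C\<close> could be strictly separated from
  \<open>C\<close>, and the support functions would then differ in a direction normal to the
  hyperplane. Exchanging \<open>C\<close> and \<open>D\<close> gives equality.\<close>

lemma is_subdifferential_subset:
  assumes "is_subdifferential \<phi> x C" "is_subdifferential \<phi> x D"
  shows "D \<subseteq> C"
proof
  fix z assume z: "z \<in> D"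
  show "z \<in> C"
  proof (rule ccontr)
    assume "z \<notin> C"
    then obtain a b where ab: "a \<bullet> z < b" "\<And>y. y \<in> C \<Longrightarrow> b < a \<bullet> y"
      using separating_hyperplane_closed_point[of C z] assms(1) compact_imp_closed
      unfolding is_subdifferential_def by blast
    \<comment> \<open>The sign is flipped because the separation puts \<open>z\<close> on the low
      side of \<open>a\<close>, whereas support functions are maxima.\<close>
    obtain v where v: "v \<in> C" "has_directional_derivative \<phi> x (- a) (v \<bullet> (- a))"
      using assms(1) unfolding is_subdifferential_def by meson
    obtain w where w: "z \<bullet> (- a) \<le> w \<bullet> (- a)" "has_directional_derivative \<phi> x (- a) (w \<bullet> (- a))"
      using assms(2) z unfolding is_subdifferential_def by meson
    have "v \<bullet> (- a) = w \<bullet> (- a)"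
      using v(2) w(2) by (rule has_directional_derivative_unique)
    then show False
      using w(1) ab(1) ab(2)[OF v(1)] by (simp add: inner_commute)
  qed
qed

lemma subdifferential_eqI:
  assumes "is_subdifferential \<phi> x C"
  shows "subdifferential \<phi> x = C"
  unfolding subdifferential_def
  using assms is_subdifferential_subset by (intro the_equality) blast+

section \<open>Directional derivatives of the max function\<close>

lemma max_function_less_iff:
  "max_function m g x < r \<longleftrightarrow> 0 < r \<and> (\<forall>i\<in>{1..m}. g i x < r)"
  by (simp add: max_function_def)

lemma max_function_ge: "i \<in> {1..m} \<Longrightarrow> g i x \<le> max_function m g x"
  unfolding max_function_def by (rule Max_ge) auto

lemma max_function_pos: "x \<notin> feasible_set m g \<Longrightarrow> 0 < max_function m g x"
  using max_function_ge[of _ m g x] by (force simp: feasible_set_def)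

lemma max_function_attained:
  assumes "0 < max_function m g x"
  obtains i where "i \<in> {1..m}" "g i x = max_function m g x"
proof -
  have "max_function m g x \<in> insert 0 ((\<lambda>i. g i x) ` {1..m})"
    unfolding max_function_def by (rule Max_in) auto
  then show thesis
    using assms that by auto
qed

text \<open>A Danskin-type formula: only the functions attaining the maximum at \<open>x\<close>
  matter for small steps, and among these the one with the steepest slope along \<open>d\<close>
  wins.\<close>

lemma has_directional_derivative_max_function:
  assumes diff: "\<And>i. i \<in> {1..m} \<Longrightarrow> g i differentiable (at x)"
    and pos: "0 < max_function m g x"
    and k: "k \<in> {1..m}" "g k x = max_function m g x"
    and k_max: "\<And>i. \<lbrakk>i \<in> {1..m}; g i x = max_function m g x\<rbrakk>
      \<Longrightarrow> gradient (g i) x \<bullet> d \<le> gradient (g k) x \<bullet> d"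
  shows "has_directional_derivative (max_function m g) x d (gradient (g k) x \<bullet> d)"
  unfolding has_directional_derivative_def
proof (rule order_tendstoI)
  let ?p = "max_function m g x"
  let ?F = "at_right (0::real)"
  have quot: "((\<lambda>t. (g i (x + t *\<^sub>R d) - g i x) / t) \<longlongrightarrow> gradient (g i) x \<bullet> d) ?F"
    if "i \<in> {1..m}" for i
    using has_directional_derivative_gradient[OF diff[OF that]]
    by (simp add: has_directional_derivative_def)
  have t_pos: "eventually (\<lambda>t. 0 < t) ?F"
    by (simp add: eventually_at_right_less)
  have line: "((\<lambda>t. x + t *\<^sub>R d) \<longlongrightarrow> x) ?F"
    by (auto intro!: tendsto_eq_intros)
  {
    fix l assume "l < gradient (g k) x \<bullet> d"
    then have "eventually (\<lambda>t. l < (g k (x + t *\<^sub>R d) - g k x) / t) ?F"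
      using quot[OF k(1)] by (simp add: order_tendstoD)
    \<comment> \<open>The max dominates \<open>g k\<close> everywhere and agrees with it at
      \<open>x\<close>, so its difference quotient is at least that of \<open>g k\<close>.\<close>
    with t_pos show "eventually (\<lambda>t. l < (max_function m g (x + t *\<^sub>R d) - ?p) / t) ?F"
    proof eventually_elim
      case (elim t)
      then show ?case
        using max_function_ge[OF k(1), of g "x + t *\<^sub>R d"] k(2) by (simp add: field_simps)
    qed
  next
    fix u assume u: "gradient (g k) x \<bullet> d < u"
    have upper: "((\<lambda>t. ?p + t * u) \<longlongrightarrow> ?p) ?F"
      by (auto intro!: tendsto_eq_intros)
    \<comment> \<open>Maximal functions stay below the line of slope \<open>u\<close> because their
      slope is less than \<open>u\<close>; the others do so by continuity, starting strictly below
      \<open>?p\<close>.\<close>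
    have "eventually (\<lambda>t. g i (x + t *\<^sub>R d) < ?p + t * u) ?F" if i: "i \<in> {1..m}" for i
    proof (cases "g i x = ?p")
      case True
      then have "eventually (\<lambda>t. (g i (x + t *\<^sub>R d) - g i x) / t < u) ?F"
        using quot[OF i] k_max[OF i] u by (simp add: order_tendstoD)
      with t_pos show ?thesis
        by eventually_elim (use True in \<open>simp add: field_simps\<close>)
    next
      case False
      then have less: "0 < ?p - g i x"
        using max_function_ge[OF i, of g x] by simp
      have "((\<lambda>t. g i (x + t *\<^sub>R d)) \<longlongrightarrow> g i x) ?F"
        using differentiable_imp_continuous_within[OF diff[OF i]] line
        by (rule isCont_tendsto_compose)
      from order_tendstoD(1)[OF tendsto_diff[OF upper this] less] show ?thesis
        by eventually_elim simp
    qed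
    then have "eventually (\<lambda>t. \<forall>i\<in>{1..m}. g i (x + t *\<^sub>R d) < ?p + t * u) ?F"
      by (simp add: eventually_ball_finite)
    \<comment> \<open>The entry 0 of the max must stay below the line as well; this is where
      positivity at \<open>x\<close> enters.\<close>
    moreover have "eventually (\<lambda>t. 0 < ?p + t * u) ?F"
      using upper pos by (simp add: order_tendstoD)
    ultimately show "eventually (\<lambda>t. (max_function m g (x + t *\<^sub>R d) - ?p) / t < u) ?F"
      using t_pos
    proof eventually_elim
      case (elim t)
      then have "max_function m g (x + t *\<^sub>R d) < ?p + t * u"
        by (simp add: max_function_less_iff)
      then show ?case
        using elim(3) by (simp add: field_simps)
    qed
  }
qed

section \<open>The subdifferential of the max function\<close>

lemma convex_hull_inner_le:
  assumes "\<And>v. v \<in> S \<Longrightarrow> v \<bullet> d \<le> b" and "w \<in> convex hull S"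
  shows "w \<bullet> d \<le> b"
proof -
  have "convex hull S \<subseteq> {v. d \<bullet> v \<le> b}"
    using assms(1) by (intro hull_minimal convex_halfspace_le) (auto simp: inner_commute)
  then show ?thesis
    using assms(2) by (auto simp: inner_commute)
qed

text \<open>A linear functional on the hull of finitely many gradients is maximal at one of them,
  and the slope of that gradient is the directional derivative of the max.\<close>

lemma subdifferential_max_function:
  assumes diff: "\<And>i. i \<in> {1..m} \<Longrightarrow> g i differentiable (at x)"
    and pos: "0 < max_function m g x"
  shows "subdifferential (max_function m g) x =
    convex hull ((\<lambda>i. gradient (g i) x) ` {i \<in> {1..m}. g i x = max_function m g x})"
proof (rule subdifferential_eqI, unfold is_subdifferential_def, intro conjI allI)
  let ?A = "{i \<in> {1..m}. g i x = max_function m g x}"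
  let ?G = "(\<lambda>i. gradient (g i) x) ` ?A"
  show "convex (convex hull ?G)" "compact (convex hull ?G)"
    by (simp_all add: finite_imp_compact_convex_hull)
  fix d
  have "finite ?A" "?A \<noteq> {}"
    using max_function_attained[OF pos] by auto
  then obtain k where k: "k \<in> ?A" "\<And>i. i \<in> ?A \<Longrightarrow> gradient (g i) x \<bullet> d \<le> gradient (g k) x \<bullet> d"
    using obtains_MAX[of ?A "\<lambda>i. gradient (g i) x \<bullet> d"] by (metis (no_types, lifting) Max_ge finite_imageI imageI)
  show "\<exists>v\<in>convex hull ?G. (\<forall>w\<in>convex hull ?G. w \<bullet> d \<le> v \<bullet> d) \<and>
      has_directional_derivative (max_function m g) x d (v \<bullet> d)"
  proof (intro bexI conjI ballI)
    show "gradient (g k) x \<in> convex hull ?G"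
      using k(1) by (intro hull_inc) auto
    show "w \<bullet> d \<le> gradient (g k) x \<bullet> d" if "w \<in> convex hull ?G" for w
      using _ that by (rule convex_hull_inner_le) (use k(2) in auto)
    show "has_directional_derivative (max_function m g) x d (gradient (g k) x \<bullet> d)"
      using k by (intro has_directional_derivative_max_function diff pos) auto
  qed
qed

section \<open>From MFCQ at the point to USC on a neighborhood\<close>

lemma MFCQ_eventually:
  assumes cd: "\<And>i. i \<in> {1..m} \<Longrightarrow> continuously_differentiable (g i)"
    and feasible: "x0 \<in> feasible_set m g" and "MFCQ m g x0"
  obtains d c where "0 < c"
    "eventually (\<lambda>x. \<forall>i\<in>{1..m}. g i x < 0 \<or> gradient (g i) x \<bullet> d < - c) (nhds x0)"
proof -
  obtain d where d: "\<And>i. \<lbrakk>i \<in> {1..m}; g i x0 = 0\<rbrakk> \<Longrightarrow> gradient (g i) x0 \<bullet> d < 0"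
    using assms(3) unfolding MFCQ_def by blast
  \<comment> \<open>Each active index admits every sufficiently small \<open>c\<close>; as there are
    finitely many, one positive \<open>c\<close> serves all of them.\<close>
  have "eventually (\<lambda>c. \<forall>i\<in>{1..m}. g i x0 = 0 \<longrightarrow> c < - (gradient (g i) x0 \<bullet> d)) (at_right 0)"
  proof (intro eventually_ball_finite ballI)
    fix i assume i: "i \<in> {1..m}"
    show "eventually (\<lambda>c. g i x0 = 0 \<longrightarrow> c < - (gradient (g i) x0 \<bullet> d)) (at_right 0)"
    proof (cases "g i x0 = 0")
      case True
      then show ?thesis
        using order_tendstoD(2)[OF tendsto_ident_at, of "0::real" "- (gradient (g i) x0 \<bullet> d)" "{0<..}"]
          d[OF i] by simp
    qed simp
  qed simp
  moreover have "eventually (\<lambda>c. 0 < c) (at_right (0::real))"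
    by (simp add: eventually_at_right_less)
  ultimately have "eventually (\<lambda>c. 0 < c \<and>
      (\<forall>i\<in>{1..m}. g i x0 = 0 \<longrightarrow> c < - (gradient (g i) x0 \<bullet> d))) (at_right 0)"
    by eventually_elim simp
  then obtain c where c: "0 < c"
    "\<And>i. \<lbrakk>i \<in> {1..m}; g i x0 = 0\<rbrakk> \<Longrightarrow> gradient (g i) x0 \<bullet> d < - c"
    using eventually_happens'[OF trivial_limit_at_right_real] by (smt (verit, best))
  have "eventually (\<lambda>x. \<forall>i\<in>{1..m}. g i x < 0 \<or> gradient (g i) x \<bullet> d < - c) (nhds x0)"
  proof (intro eventually_ball_finite ballI)
    fix i assume i: "i \<in> {1..m}"
    have "isCont (g i) x0" "isCont (gradient (g i)) x0"
      using cd[OF i] by (auto simp: continuously_differentiable_def continuous_on_eq_continuous_at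
          intro: differentiable_imp_continuous_within)
    then have lim: "(g i \<longlongrightarrow> g i x0) (nhds x0)"
      "((\<lambda>x. gradient (g i) x \<bullet> d) \<longlongrightarrow> gradient (g i) x0 \<bullet> d) (nhds x0)"
      by (auto simp: isCont_def tendsto_nhds_iff intro!: tendsto_intros)
    show "eventually (\<lambda>x. g i x < 0 \<or> gradient (g i) x \<bullet> d < - c) (nhds x0)"
    proof (cases "g i x0 = 0")
      case True
      show ?thesis
        using order_tendstoD(2)[OF lim(2) c(2)[OF i True]] by eventually_elim simp
    next
      case False
      then have "g i x0 < 0"
        using feasible i by (force simp: feasible_set_def)
      from order_tendstoD(2)[OF lim(1) this] show ?thesis
        by eventually_elim simp
    qed
  qed simp
  with c(1) show thesis
    by (rule that)
qed

theorem theorem4p3: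
  fixes g :: "nat \<Rightarrow> real ^ 'n \<Rightarrow> real" and m :: nat and xstar :: "real ^ 'n"
  assumes "\<And>i. i \<in> {1..m} \<Longrightarrow> continuously_differentiable (g i)"
    and "xstar \<in> feasible_set m g"
    and "MFCQ m g xstar"
  shows "USC m g xstar"
proof -
  obtain d c where c: "0 < c" and ev:
    "eventually (\<lambda>x. \<forall>i\<in>{1..m}. g i x < 0 \<or> gradient (g i) x \<bullet> d < - c) (nhds xstar)"
    using MFCQ_eventually[OF assms] by blast
  obtain B where B: "open B" "xstar \<in> B"
    "\<And>x i. \<lbrakk>x \<in> B; i \<in> {1..m}\<rbrakk> \<Longrightarrow> g i x < 0 \<or> gradient (g i) x \<bullet> d < - c"
    using ev unfolding eventually_nhds by blast
  \<comment> \<open>\<open>d\<close> may vanish when no constraint is active at \<open>xstar\<close>.\<close>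
  let ?a = "c / (norm d + 1)"
  have dpos: "0 < norm d + 1"
    by (simp add: add_nonneg_pos)
  have "?a \<le> infdist 0 (subdifferential (max_function m g) x)"
    if x: "x \<in> B - feasible_set m g" for x
  proof -
    let ?A = "{i \<in> {1..m}. g i x = max_function m g x}"
    let ?C = "convex hull ((\<lambda>i. gradient (g i) x) ` ?A)"
    have pos: "0 < max_function m g x"
      using x by (simp add: max_function_pos)
    have sub: "subdifferential (max_function m g) x = ?C"
      using assms(1) pos
      by (intro subdifferential_max_function) (auto simp: continuously_differentiable_def)
    \<comment> \<open>Nonemptiness matters because \<open>infdist\<close> to the empty set is 0 by
      convention.\<close>
    have "?C \<noteq> {}"
      using max_function_attained[OF pos] by auto
    moreover have "?a \<le> dist 0 v" if v: "v \<in> ?C" for v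
    proof -
      \<comment> \<open>For an index in \<open>?A\<close> the value \<open>g i x\<close> is
        positive, which leaves only the gradient alternative of \<open>B(3)\<close>.\<close>
      have "v \<bullet> d \<le> - c"
        using _ v by (rule convex_hull_inner_le) (use B(3) x pos in force)
      then have "c \<le> norm v * norm d"
        using Cauchy_Schwarz_ineq2[of v d] by linarith
      also have "\<dots> \<le> norm v * (norm d + 1)"
        by (simp add: mult_left_mono)
      finally show ?thesis
        using dpos by (simp add: pos_divide_le_eq)
    qed
    ultimately show ?thesis
      unfolding sub by (simp add: infdist_notempty cINF_greatest)
  qed
  moreover have "0 < ?a"
    using c dpos by simp
  ultimately show ?thesis
    unfolding USC_def using B(1,2) by blast
qed

end
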